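(* Let $X_1,X_2,\dots$ be independent positive random variables with distribution functions $F_i(x)=P(X_i\le x)$ satisfying $F_i(0)=0$ and $F_i(x)>0$ for all $x>0$, and put $\nu_i(x)=-\ln F_i(x)$ for $x>0$. Assume that each $\nu_i$ is continuous and strictly decreasing on $(0,\infty)$ (so each $F_i$ is strictly monotonic there). Let $\alpha>0$, let $c_1,c_2,\dots$ be positive constants, and suppose that for all $i$ and all $x>0$ $$\nu_i(x)=c_i\,x^{-\alpha}\,(1+\delta_i(x)),$$ where all $\delta_i$ are continuous, $\delta_i(x)\to0$ as $x\to\infty$ uniformly in $i$, and there are positive constants $M<\infty$ and $m<1$ with $-m\le\delta_i(x)\le M$ for all $i$ and $x$. Put $d_n=\sum_{j=1}^n c_j$ and suppose that, as $n\to\infty$, $d_n\to\infty$ and $\frac{\max_{j\le n}c_j}{d_n}\to0$, and that the measures $\mu_n=\sum_{j=1}^n\frac{c_j}{d_n}\delta_{\{j/n\}}$ on $[0,1]$ converge weakly to some measure $\mu$. Let $X_{n,j}=d_n^{-1/\alpha}X_j$ for $j\le n$. Then, as $n\to\infty$, $$\frac1n\,\mathrm{argmax}_{j\le n}\{X_{n,j}\}=\frac1n\,\mathrm{argmax}_{j\le n}\{d_n^{-1/\alpha}X_j\}\Longrightarrow\mu.$$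
   Context: $\delta_{\{a\}}$ is the unit mass at the point $a$ (not to be confused with the functions $\delta_i(x)$). $\mathrm{argmax}_{j\le n}\{X_{n,j}\}$ is the (a.s. unique) index $j\in\{1,\dots,n\}$ at which $\max_{j\le n}X_{n,j}$ is attained. $\Longrightarrow\mu$ means that the distributions of the random variables converge weakly to $\mu$. *)

theory Defs
  imports "HOL-Probability.Probability"
begin

text \<open>
  The measure giving mass \<open>w j\<close> to each of the points \<open>j / n\<close>, \<open>j = 1, \<dots>, n\<close>;
  \<open>return borel a\<close> is the unit mass at \<open>a\<close>. Measures on \<open>[0,1]\<close> are regarded as Borel measures
  on the real line without mass outside \<open>[0,1]\<close>, so that \<^const>\<open>weak_conv_m\<close> applies.
\<close>
definition grid_measure :: "(nat \<Rightarrow> real) \<Rightarrow> nat \<Rightarrow> real measure" where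
  "grid_measure w n = measure_of UNIV (sets borel)
     (\<lambda>A. \<Sum>j=1..n. ennreal (w j) * emeasure (return borel (real j / real n)) A)"

lemma sets_grid_measure [simp, measurable_cong]: "sets (grid_measure w n) = sets borel"
  unfolding grid_measure_def using sets.sigma_sets_eq[of "borel :: real measure"]
  by (simp add: sets_measure_of_conv)

text \<open>
  \<^const>\<open>measure_of\<close> yields the zero measure unless the given set function is countably additive;
  the following shows that this is the case.
\<close>
lemma emeasure_grid_measure:
  assumes "A \<in> sets borel"
  shows "emeasure (grid_measure w n) A =
    (\<Sum>j=1..n. ennreal (w j) * emeasure (return borel (real j / real n)) A)"
proof (rule emeasure_measure_of[OF grid_measure_def])
  show "countably_additive (sets (grid_measure w n))
     (\<lambda>A. \<Sum>j=1..n. ennreal (w j) * emeasure (return borel (real j / real n)) A)"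
    unfolding countably_additive_def
  proof (intro allI impI)
    fix A :: "nat \<Rightarrow> real set"
    assume "range A \<subseteq> sets (grid_measure w n)" and disj: "disjoint_family A"
    then have "range A \<subseteq> sets (return borel a)" for a
      by simp
    then have "(\<Sum>i. emeasure (return borel a) (A i)) = emeasure (return borel a) (\<Union>i. A i)" for a
      using disj by (rule suminf_emeasure)
    then show "(\<Sum>i. \<Sum>j=1..n. ennreal (w j) * emeasure (return borel (real j / real n)) (A i)) =
      (\<Sum>j=1..n. ennreal (w j) * emeasure (return borel (real j / real n)) (\<Union>i. A i))"
      by (simp only: suminf_sum[OF summableI] ennreal_suminf_cmult)
  qed
qed (use assms in \<open>auto simp: positive_def\<close>)

end

theory Submission
  imports Defs
begin

text \<open>
  The index of the maximum has asymptotically the weights \<open>c j / d n\<close> themselves: for every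
  \<open>\<eta> > 0\<close> there is an \<open>n\<^sub>0\<close> such that, for all \<open>n \<ge> n\<^sub>0\<close> and all \<open>j \<le> n\<close>, the index \<open>j\<close> is attained
  with probability at least \<open>(1 - \<eta>) * (c j / d n)\<close>. Since both families of weights have total mass 1,
  such one-sided bounds suffice: applied to a set \<open>B\<close> of indices and to its complement, they show that
  the two masses of \<open>B\<close> differ by at most \<open>\<eta>\<close> (\<open>prob_near_weights\<close>). Hence the distribution functions
  of the normalised argmax and of the weighted grid measure have the same limits.

  The lower bound comes from the following computation. Write \<open>\<nu> i = - ln (F i)\<close>. Conditionally on
  \<open>X j\<close>, the index \<open>j\<close> is a strict maximum with probability \<open>exp (- (\<Sum>i\<noteq>j. \<nu> i (X j)))\<close>, by independence.
  If the \<open>\<nu> i\<close> were exact multiples of one function, with factors \<open>c i\<close>, this would be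
  \<open>exp (- (r - 1) * S)\<close> with \<open>r = d n / c j\<close> and \<open>S = \<nu> j (X j)\<close>. Now \<open>S\<close> is a standard
  exponential variable, because \<open>F j (X j)\<close> is uniform, so the expectation would be
  \<open>1 / r = c j / d n\<close>. In general the \<open>\<nu> i\<close> are, up to factors \<open>1 \<plusminus> \<epsilon>\<close>, proportional only
  beyond some level \<open>a\<close> that depends on neither \<open>i\<close> nor \<open>n\<close>. This changes \<open>r\<close> by the factor
  \<open>(1 + \<epsilon>) / (1 - \<epsilon>)\<close>, and discarding the event \<open>X j \<le> a\<close> costs at most the relative error
  \<open>exp (- d n * a powr (- \<alpha>))\<close>, which tends to 0 because \<open>d n\<close> tends to infinity
  (\<open>prob_strict_max_ge\<close> and \<open>prob_strict_max_ge_power_tail\<close>).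

  The normalisation by \<open>d n powr (- 1 / \<alpha>)\<close> does not move the argmax, and ties need no separate
  treatment, since the lower bound already holds for the event of a strict maximum.
\<close>

section \<open>The probability integral transform\<close>

lemma (in real_distribution) borel_measurable_cdf [measurable]: "cdf M \<in> borel_measurable borel"
  by (rule borel_measurable_mono) (simp add: mono_def cdf_nondecreasing)

text \<open>
  Continuity makes every level in \<open>(0, 1)\<close> a value of the distribution function. As the latter need
  not be injective, the lower estimate compares with levels \<open>q < p\<close> and lets \<open>q\<close> tend to \<open>p\<close>.
\<close>
lemma (in real_distribution) measure_cdf_less:
  assumes cont: "\<And>x. isCont (cdf M) x" and p: "0 \<le> p" "p \<le> 1"
  shows "measure M {x. cdf M x < p} = p"
proof (rule antisym)
  have attained: "\<exists>x. cdf M x = q" if q: "0 < q" "q < 1" for q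
  proof -
    have "\<forall>\<^sub>F x in at_bot. cdf M x < q"
      by (rule order_tendstoD(2)[OF cdf_lim_at_bot]) (use q in auto)
    then obtain a where a: "cdf M a < q"
      by (auto simp: eventually_at_bot_linorder)
    have "\<forall>\<^sub>F x in at_top. q < cdf M x"
      by (rule order_tendstoD(1)[OF cdf_lim_at_top_prob]) (use q in auto)
    then obtain b where b: "q < cdf M b"
      by (auto simp: eventually_at_top_linorder)
    have "a \<le> b"
      using a b cdf_nondecreasing[of b a] by linarith
    then show ?thesis
      using IVT[of "cdf M" a q b] a b cont by (auto intro: less_imp_le)
  qed
  show "measure M {x. cdf M x < p} \<le> p"
  proof (cases "0 < p \<and> p < 1")
    case True
    then obtain x where x: "cdf M x = p"
      using attained by blast
    have "{y. cdf M y < p} \<subseteq> {..x}"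
      using x cdf_nondecreasing by (metis (mono_tags, lifting) atMost_iff leD mem_Collect_eq nle_le subsetI)
    then have "measure M {y. cdf M y < p} \<le> measure M {..x}"
      by (intro finite_measure_mono) auto
    then show ?thesis
      using x by (simp add: cdf_def)
  next
    case False
    then consider "p = 0" | "p = 1"
      using p by linarith
    then show ?thesis
    proof cases
      case 1
      then show ?thesis
        using cdf_nonneg by (simp add: not_less[symmetric])
    qed simp
  qed
  show "p \<le> measure M {x. cdf M x < p}"
  proof (rule dense_ge)
    fix q' assume q': "measure M {x. cdf M x < p} < q'"
    show "p \<le> q'"
    proof (rule dense_le)
      fix q assume "q < p"
      show "q \<le> q'"
      proof (cases "0 < q")
        case True
        then obtain x where x: "cdf M x = q"
          using attained \<open>q < p\<close> p by force
        have "{..x} \<subseteq> {y. cdf M y < p}"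
          using x cdf_nondecreasing \<open>q < p\<close> by fastforce
        then have "measure M {..x} \<le> measure M {y. cdf M y < p}"
          by (intro finite_measure_mono) auto
        then show ?thesis
          using x q' by (simp add: cdf_def)
      next
        case False
        then show ?thesis
          using q' measure_nonneg[of M "{x. cdf M x < p}"] by linarith
      qed
    qed
  qed
qed

lemma (in real_distribution) AE_cdf_pos:
  assumes cont: "\<And>x. isCont (cdf M) x"
  shows "AE x in M. 0 < cdf M x"
proof -
  have null: "measure M {x. cdf M x \<le> 0} = 0"
  proof (rule antisym)
    show "measure M {x. cdf M x \<le> 0} \<le> 0"
    proof (rule dense_ge)
      fix p :: real assume "0 < p"
      have "measure M {x. cdf M x \<le> 0} \<le> measure M {x. cdf M x < min p 1}"
        using \<open>0 < p\<close> by (intro finite_measure_mono) auto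
      also have "\<dots> = min p 1"
        using \<open>0 < p\<close> by (intro measure_cdf_less cont) auto
      finally show "measure M {x. cdf M x \<le> 0} \<le> p"
        by simp
    qed
  qed simp
  then have "AE x in M. \<not> cdf M x \<le> 0"
    by (subst prob_Collect_eq_0[symmetric]) auto
  then show ?thesis
    by (simp add: not_le)
qed

text \<open>
  The values \<open>cdf M x = 0\<close>, where \<open>ln\<close> takes the default value 0, form a null set.
\<close>
lemma (in real_distribution) distributed_minus_ln_cdf:
  assumes cont: "\<And>x. isCont (cdf M) x"
  shows "distributed M lborel (\<lambda>x. - ln (cdf M x)) (exponential_density 1)"
proof -
  have meas: "(\<lambda>x. - ln (cdf M x)) \<in> borel_measurable M"
    by measurable
  have null: "measure M {x. cdf M x \<le> 0} = 0"
    using AE_cdf_pos[OF cont] prob_Collect_eq_0[of "\<lambda>x. cdf M x \<le> 0"] by (simp add: not_le)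
  have "\<P>(x in M. - ln (cdf M x) \<le> a) = 1 - exp (- a * 1)" if "0 \<le> a" for a
  proof -
    have iff: "a < - ln y \<longleftrightarrow> y < exp (- a) \<and> \<not> y \<le> 0" if "0 \<le> y" for y
    proof (cases "y = 0")
      case False
      then have "ln y < - a \<longleftrightarrow> y < exp (- a)"
        using \<open>0 \<le> y\<close> by (metis exp_less_cancel_iff exp_ln less_le)
      then show ?thesis
        using False \<open>0 \<le> y\<close> by auto
    qed (use \<open>0 \<le> a\<close> in simp)
    have eq: "{x. a < - ln (cdf M x)} = {x. cdf M x < exp (- a)} - {x. cdf M x \<le> 0}"
      using iff[OF cdf_nonneg] by blast
    have "measure M {x. a < - ln (cdf M x)} = exp (- a)"
      using null measure_cdf_less[OF cont, of "exp (- a)"] \<open>0 \<le> a\<close>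
      by (subst eq, subst finite_measure_Diff) (auto intro: le_less_trans)
    moreover have "measure M (space M - {x. a < - ln (cdf M x)}) =
        1 - measure M {x. a < - ln (cdf M x)}"
      by (rule prob_compl) measurable
    moreover have "space M - {x. a < - ln (cdf M x)} = {x \<in> space M. - ln (cdf M x) \<le> a}"
      by auto
    ultimately show ?thesis
      by simp
  qed
  then show ?thesis
    using meas by (subst exponential_distributed_iff) auto
qed

text \<open>
  Multiplying by the exponential density turns the integrand into \<open>exp (- r * s)\<close>; the truncation at
  \<open>t\<close> corresponds to observing only large values of \<open>X j\<close>.
\<close>
lemma (in prob_space) expectation_truncated_exponential:
  assumes D: "distributed M lborel S (exponential_density 1)" and r: "0 < r" and t: "0 \<le> t"
  shows "expectation (\<lambda>x. exp (- (r - 1) * S x) * indicator {..<t} (S x)) = (1 - exp (- r * t)) / r"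
proof -
  have "expectation (\<lambda>x. exp (- (r - 1) * S x) * indicator {..<t} (S x)) =
      (\<integral>s. exponential_density 1 s * (exp (- (r - 1) * s) * indicator {..<t} s) \<partial>lborel)"
    by (rule distributed_integral[OF D, symmetric]) (auto simp: exponential_density_def)
  also have "\<dots> = (\<integral>s. indicator {0..t} s *\<^sub>R exp (- r * s) \<partial>lborel)"
  proof (rule integral_cong_AE)
    show "AE s in lborel. exponential_density 1 s * (exp (- (r - 1) * s) * indicator {..<t} s) =
        indicator {0..t} s *\<^sub>R exp (- r * s)"
      using AE_lborel_singleton[of t]
      by eventually_elim
        (auto simp: exponential_density_def indicator_def exp_add[symmetric] algebra_simps)
  qed measurable
  also have "\<dots> = - exp (- r * t) / r - (- exp (- r * 0) / r)"
  proof (rule integral_FTC_Icc)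
    show "((\<lambda>s. - exp (- r * s) / r) has_vector_derivative exp (- r * s)) (at s within {0..t})" for s
      using r by (auto intro!: derivative_eq_intros simp flip: has_real_derivative_iff_has_vector_derivative)
  qed (use t in \<open>auto intro!: continuous_intros\<close>)
  finally show ?thesis
    using r by (simp add: diff_divide_distrib)
qed

section \<open>The probability of a strict maximum\<close>

text \<open>
  Conditioning on \<open>X j\<close>, carried out as Fubini's theorem for the product of the laws of \<open>X j\<close> and of
  the family of competitors. Continuity allows the strict inequality to be evaluated by
  distribution functions.
\<close>
lemma (in prob_space) prob_strict_max_eq:
  fixes X :: "'i \<Rightarrow> 'a \<Rightarrow> real"
  assumes indep: "indep_vars (\<lambda>_. borel) X K" and I: "finite I" "I \<subseteq> K" and j: "j \<in> K" "j \<notin> I"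
    and cont: "\<And>i x. i \<in> I \<Longrightarrow> isCont (cdf (distr M borel (X i))) x"
  shows "prob {\<omega> \<in> space M. \<forall>i\<in>I. X i \<omega> < X j \<omega>} =
    expectation (\<lambda>\<omega>. \<Prod>i\<in>I. cdf (distr M borel (X i)) (X j \<omega>))"
proof -
  let ?F = "\<lambda>i. cdf (distr M borel (X i))"
  have "random_variable borel (X i)" if "i \<in> K" for i
    using indep that by (auto simp: indep_vars_def)
  then have [measurable]: "random_variable borel (X j)" "\<And>i. i \<in> I \<Longrightarrow> random_variable borel (X i)"
    using I j by auto
  have F: "real_distribution (distr M borel (X i))" if "i \<in> I" for i
    using that by simp
  have [measurable]: "?F i \<in> borel_measurable borel" if "i \<in> I" for i
    using real_distribution.borel_measurable_cdf[OF F[OF that]] .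
  have F0: "0 \<le> ?F i x" and F1: "?F i x \<le> 1" if "i \<in> I" for i x
    using that by (simp_all add: cdf_def real_distribution.cdf_bounded_prob[OF F, unfolded cdf_def])
  (* X j is kept as a one-element family, since independence of two random variables is
     expressed for variables with values in the same type. *)
  define Y where "Y = (\<lambda>\<omega>. restrict (\<lambda>i. X i \<omega>) I)"
  define Z where "Z = (\<lambda>\<omega>. restrict (\<lambda>i. X i \<omega>) {j})"
  define B where "B = Pi\<^sub>M I (\<lambda>_. borel :: real measure)"
  define C where "C = Pi\<^sub>M {j} (\<lambda>_. borel :: real measure)"
  have Y[measurable]: "Y \<in> measurable M B" and Z[measurable]: "Z \<in> measurable M C"
    unfolding Y_def B_def Z_def C_def by (auto intro!: measurable_restrict)
  have ind: "indep_var C Z B Y"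
    unfolding B_def C_def Y_def Z_def by (rule indep_var_restrict[OF indep]) (use I j in auto)
  interpret N: prob_space "distr M B Y"
    by (rule prob_space_distr) measurable
  define A where "A = {z \<in> space (C \<Otimes>\<^sub>M B). \<forall>i\<in>I. snd z i < fst z j}"
  have A[measurable]: "A \<in> sets (C \<Otimes>\<^sub>M B)"
    unfolding A_def B_def C_def using I by measurable
  have slice: "emeasure (distr M B Y) (Pair z -` A) = ennreal (\<Prod>i\<in>I. ?F i (z j))"
    if z: "z \<in> space C" for z
  proof -
    have "Pair z -` A \<in> sets B"
      by (rule sets_Pair1[OF A])
    then have "emeasure (distr M B Y) (Pair z -` A) = emeasure M (Y -` (Pair z -` A) \<inter> space M)"
      by (intro emeasure_distr) auto
    also have "Y -` (Pair z -` A) \<inter> space M = {\<omega>\<in>space M. \<forall>i\<in>I. X i \<omega> < z j}"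
      using measurable_space[OF Y] z by (auto simp: A_def Y_def space_pair_measure)
    also have "emeasure M \<dots> = ennreal (\<Prod>i\<in>I. ?F i (z j))"
    proof (cases "I = {}")
      case True
      then show ?thesis
        by (simp add: emeasure_space_1)
    next
      case False
      have "{\<omega>\<in>space M. \<forall>i\<in>I. X i \<omega> < z j} = (\<Inter>i\<in>I. X i -` {..<z j} \<inter> space M)"
        using False by auto
      also have "prob \<dots> = (\<Prod>i\<in>I. prob (X i -` {..<z j} \<inter> space M))"
        using False I by (intro indep_varsD[OF indep]) auto
      also have "\<dots> = (\<Prod>i\<in>I. ?F i (z j))"
      proof (rule prod.cong)
        fix i assume i: "i \<in> I"
        have "(?F i \<longlongrightarrow> ?F i (z j)) (at_left (z j))"
          using cont[OF i] by (auto simp: isCont_def filterlim_at_split)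
        moreover have "(?F i \<longlongrightarrow> measure (distr M borel (X i)) {..<z j}) (at_left (z j))"
          using real_distribution.finite_borel_measure_M[OF F[OF i]]
          by (rule finite_borel_measure.cdf_at_left)
        ultimately have "?F i (z j) = measure (distr M borel (X i)) {..<z j}"
          by (rule tendsto_unique[rotated]) simp
        also have "\<dots> = prob (X i -` {..<z j} \<inter> space M)"
          using i by (intro measure_distr) auto
        finally show "prob (X i -` {..<z j} \<inter> space M) = ?F i (z j)" ..
      qed simp
      finally show ?thesis
        by (simp add: emeasure_eq_measure)
    qed
    finally show ?thesis .
  qed
  have "ennreal (prob {\<omega> \<in> space M. \<forall>i\<in>I. X i \<omega> < X j \<omega>}) =
      emeasure M ((\<lambda>\<omega>. (Z \<omega>, Y \<omega>)) -` A \<inter> space M)"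
  proof -
    have "(\<lambda>\<omega>. (Z \<omega>, Y \<omega>)) -` A \<inter> space M = {\<omega> \<in> space M. \<forall>i\<in>I. X i \<omega> < X j \<omega>}"
      using measurable_space[OF Y] measurable_space[OF Z]
      by (auto simp: A_def Y_def Z_def space_pair_measure)
    then show ?thesis
      by (simp add: emeasure_eq_measure)
  qed
  also have "\<dots> = emeasure (distr M (C \<Otimes>\<^sub>M B) (\<lambda>\<omega>. (Z \<omega>, Y \<omega>))) A"
    by (rule emeasure_distr[symmetric]) auto
  also have "\<dots> = emeasure (distr M C Z \<Otimes>\<^sub>M distr M B Y) A"
    using ind by (simp add: indep_var_distribution_eq)
  also have "\<dots> = (\<integral>\<^sup>+z. emeasure (distr M B Y) (Pair z -` A) \<partial>distr M C Z)"
    by (rule N.emeasure_pair_measure_alt) simp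
  also have "\<dots> = (\<integral>\<^sup>+z. ennreal (\<Prod>i\<in>I. ?F i (z j)) \<partial>distr M C Z)"
    by (rule nn_integral_cong) (simp add: slice)
  also have "\<dots> = (\<integral>\<^sup>+\<omega>. ennreal (\<Prod>i\<in>I. ?F i (Z \<omega> j)) \<partial>M)"
    by (rule nn_integral_distr[OF Z]) (simp add: C_def)
  also have "\<dots> = (\<integral>\<^sup>+\<omega>. ennreal (\<Prod>i\<in>I. ?F i (X j \<omega>)) \<partial>M)"
    by (simp add: Z_def)
  also have "\<dots> = ennreal (expectation (\<lambda>\<omega>. \<Prod>i\<in>I. ?F i (X j \<omega>)))"
  proof (rule nn_integral_eq_integral)
    show "integrable M (\<lambda>\<omega>. \<Prod>i\<in>I. ?F i (X j \<omega>))"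
    proof (rule integrable_const_bound[where B = 1])
      show "AE \<omega> in M. norm (\<Prod>i\<in>I. ?F i (X j \<omega>)) \<le> 1"
        by (auto simp: abs_prod F0 F1 intro!: AE_I2 prod_le_1)
    qed measurable
  qed (auto intro!: AE_I2 prod_nonneg simp: F0)
  finally show ?thesis
    by (subst (asm) ennreal_inj) (auto intro!: integral_nonneg_AE AE_I2 prod_nonneg simp: F0)
qed

text \<open>
  On the event \<open>X j > a\<close> the conditional probability of winning is at least
  \<open>exp (- (r - 1) * \<nu> j (X j))\<close>, and \<open>\<nu> j (X j)\<close> is a standard exponential variable. The bound involves
  the competitors only through \<open>r\<close>, which plays the role of the total hazard relative to that of \<open>j\<close>.
\<close>
lemma (in prob_space) prob_strict_max_ge:
  fixes X :: "'i \<Rightarrow> 'a \<Rightarrow> real"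
  defines "\<nu> \<equiv> \<lambda>i x. - ln (cdf (distr M borel (X i)) x)"
  assumes indep: "indep_vars (\<lambda>_. borel) X K" and I: "finite I" "I \<subseteq> K" and j: "j \<in> K" "j \<notin> I"
    and cont: "\<And>i x. i \<in> insert j I \<Longrightarrow> isCont (cdf (distr M borel (X i))) x"
    and pos: "\<And>i x. i \<in> insert j I \<Longrightarrow> a \<le> x \<Longrightarrow> 0 < cdf (distr M borel (X i)) x"
    and r: "0 < r" and dom: "\<And>x. a < x \<Longrightarrow> (\<Sum>i\<in>I. \<nu> i x) \<le> (r - 1) * \<nu> j x"
  shows "(1 - exp (- r * \<nu> j a)) / r \<le> prob {\<omega> \<in> space M. \<forall>i\<in>I. X i \<omega> < X j \<omega>}"
proof -
  let ?F = "\<lambda>i. cdf (distr M borel (X i))"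
  have rv: "random_variable borel (X i)" if "i \<in> insert j I" for i
    using indep that I j by (auto simp: indep_vars_def)
  then have Xj [measurable]: "random_variable borel (X j)"
    by simp
  then interpret Nj: real_distribution "distr M borel (X j)"
    by (rule real_distribution_distr)
  have F: "real_distribution (distr M borel (X i))" if "i \<in> insert j I" for i
    using rv[OF that] by (rule real_distribution_distr)
  have [measurable]: "?F i \<in> borel_measurable borel" if "i \<in> I" for i
    using real_distribution.borel_measurable_cdf[OF F] that by simp
  have F0: "0 \<le> ?F i x" and F1: "?F i x \<le> 1" if "i \<in> insert j I" for i x
    using real_distribution.cdf_bounded_prob[OF F[OF that]] by (simp_all add: cdf_def)
  have [measurable]: "\<nu> j \<in> borel_measurable borel"
    unfolding \<nu>_def by measurable
  have \<nu>a: "0 \<le> \<nu> j a"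
    using F1[of j a] pos[of j a] by (simp add: \<nu>_def)
  have pointwise: "exp (- (r - 1) * \<nu> j x) * indicator {..<\<nu> j a} (\<nu> j x) \<le> (\<Prod>i\<in>I. ?F i x)"
    if Fx: "0 < ?F j x" for x
  proof (cases "\<nu> j x < \<nu> j a")
    case True
    then have "?F j a < ?F j x"
      using pos[of j a] Fx by (simp add: \<nu>_def)
    then have "a < x"
      using Nj.cdf_nondecreasing by (meson leD leI)
    have "exp (- (r - 1) * \<nu> j x) \<le> exp (- (\<Sum>i\<in>I. \<nu> i x))"
      using dom[OF \<open>a < x\<close>] by (simp add: algebra_simps)
    also have "\<dots> = (\<Prod>i\<in>I. ?F i x)"
      using pos \<open>a < x\<close> I by (simp add: \<nu>_def sum_negf exp_sum)
    finally show ?thesis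
      using True by simp
  qed (use F0 in \<open>auto intro!: prod_nonneg\<close>)
  have Fpos: "AE x in distr M borel (X j). 0 < ?F j x"
    by (rule Nj.AE_cdf_pos) (use cont in auto)
  have exp1: "distributed (distr M borel (X j)) lborel (\<nu> j) (exponential_density 1)"
    unfolding \<nu>_def by (rule Nj.distributed_minus_ln_cdf) (use cont in auto)
  have "(1 - exp (- r * \<nu> j a)) / r =
      Nj.expectation (\<lambda>x. exp (- (r - 1) * \<nu> j x) * indicator {..<\<nu> j a} (\<nu> j x))"
    using Nj.expectation_truncated_exponential[OF exp1 r \<nu>a] by simp
  also have "\<dots> \<le> Nj.expectation (\<lambda>x. \<Prod>i\<in>I. ?F i x)"
  proof (rule integral_mono_AE')
    show "integrable (distr M borel (X j)) (\<lambda>x. \<Prod>i\<in>I. ?F i x)"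
    proof (rule Nj.integrable_const_bound[where B = 1])
      show "AE x in distr M borel (X j). norm (\<Prod>i\<in>I. ?F i x) \<le> 1"
        by (auto simp: abs_prod F0 F1 intro!: AE_I2 prod_le_1)
    qed measurable
    show "AE x in distr M borel (X j).
        exp (- (r - 1) * \<nu> j x) * indicator {..<\<nu> j a} (\<nu> j x) \<le> (\<Prod>i\<in>I. ?F i x)"
      using Fpos by eventually_elim (rule pointwise)
  qed (use F0 in \<open>auto intro!: prod_nonneg AE_I2\<close>)
  also have "\<dots> = prob {\<omega> \<in> space M. \<forall>i\<in>I. X i \<omega> < X j \<omega>}"
    using cont by (subst prob_strict_max_eq[OF indep I j]) (auto intro!: integral_distr)
  finally show ?thesis .
qed

text \<open>
  If all tails are \<open>c i * x powr (- \<alpha>)\<close> up to factors \<open>1 \<plusminus> \<epsilon>\<close>, then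
  \<open>r = (1 + \<epsilon>) / (1 - \<epsilon>) * (sum c J / c j)\<close> is an admissible ratio.
\<close>
lemma (in prob_space) prob_strict_max_ge_power_tail:
  fixes X :: "'i \<Rightarrow> 'a \<Rightarrow> real" and c :: "'i \<Rightarrow> real" and a \<epsilon> \<alpha> :: real
  assumes indep: "indep_vars (\<lambda>_. borel) X K" and J: "finite J" "J \<subseteq> K" and j: "j \<in> J"
    and cont: "\<And>i x. i \<in> J \<Longrightarrow> isCont (cdf (distr M borel (X i))) x"
    and pos: "\<And>i x. i \<in> J \<Longrightarrow> a \<le> x \<Longrightarrow> 0 < cdf (distr M borel (X i)) x"
    and c: "\<And>i. i \<in> J \<Longrightarrow> 0 < c i" and \<epsilon>: "0 < \<epsilon>" "\<epsilon> < 1"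
    and upper: "\<And>i x. i \<in> J \<Longrightarrow> a \<le> x \<Longrightarrow>
      - ln (cdf (distr M borel (X i)) x) \<le> c i * x powr (- \<alpha>) * (1 + \<epsilon>)"
    and lower: "\<And>i x. i \<in> J \<Longrightarrow> a \<le> x \<Longrightarrow>
      c i * x powr (- \<alpha>) * (1 - \<epsilon>) \<le> - ln (cdf (distr M borel (X i)) x)"
  shows "(1 - exp (- sum c J * a powr (- \<alpha>))) * ((1 - \<epsilon>) / (1 + \<epsilon>)) * (c j / sum c J)
    \<le> prob {\<omega> \<in> space M. \<forall>i\<in>J - {j}. X i \<omega> < X j \<omega>}"
proof -
  define \<nu> where "\<nu> i x = - ln (cdf (distr M borel (X i)) x)" for i x
  define r where "r = (1 + \<epsilon>) / (1 - \<epsilon>) * (sum c J / c j)"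
  have cj: "0 < c j"
    using c j .
  have cJ: "c j \<le> sum c J"
    using c J by (intro member_le_sum j) (auto intro: less_imp_le)
  have r: "0 < r"
    using cj cJ \<epsilon> by (auto simp: r_def)
  have dom: "(\<Sum>i\<in>J - {j}. \<nu> i x) \<le> (r - 1) * \<nu> j x" if x: "a < x" for x
  proof -
    have "(\<Sum>i\<in>J - {j}. \<nu> i x) \<le> (\<Sum>i\<in>J - {j}. c i * x powr (- \<alpha>) * (1 + \<epsilon>))"
      unfolding \<nu>_def using upper x by (intro sum_mono) auto
    also have "\<dots> = x powr (- \<alpha>) * ((1 + \<epsilon>) * (sum c J - c j))"
      using J j by (simp add: sum_diff1 flip: sum_distrib_right)
    (* r is chosen so that the next bound equals r - 1 times the lower bound for \<nu> j x. *)
    also have "\<dots> \<le> x powr (- \<alpha>) * ((1 + \<epsilon>) * sum c J - (1 - \<epsilon>) * c j)"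
      using \<epsilon> cj by (intro mult_left_mono) (auto simp: algebra_simps)
    also have "\<dots> = (r - 1) * (c j * x powr (- \<alpha>) * (1 - \<epsilon>))"
      using \<epsilon> cj by (simp add: r_def field_simps)
    also have "\<dots> \<le> (r - 1) * \<nu> j x"
    proof (rule mult_left_mono)
      have "1 * 1 \<le> (1 + \<epsilon>) / (1 - \<epsilon>) * (sum c J / c j)"
        using \<epsilon> cj cJ by (intro mult_mono) auto
      then show "0 \<le> r - 1"
        by (simp add: r_def)
    qed (use lower[OF j, of x] x in \<open>simp add: \<nu>_def\<close>)
    finally show ?thesis .
  qed
  have "sum c J * a powr (- \<alpha>) \<le> (1 + \<epsilon>) * (sum c J * a powr (- \<alpha>))"
    using \<epsilon> cj cJ by (simp add: algebra_simps)
  also have "\<dots> = r * (c j * a powr (- \<alpha>) * (1 - \<epsilon>))"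
    using \<epsilon> cj by (simp add: r_def field_simps)
  also have "\<dots> \<le> r * \<nu> j a"
    using r lower[OF j, of a] by (intro mult_left_mono) (auto simp: \<nu>_def)
  finally have "(1 - exp (- sum c J * a powr (- \<alpha>))) / r \<le> (1 - exp (- r * \<nu> j a)) / r"
    using r by (intro divide_right_mono) auto
  also have "\<dots> \<le> prob {\<omega> \<in> space M. \<forall>i\<in>J - {j}. X i \<omega> < X j \<omega>}"
    unfolding \<nu>_def
    by (rule prob_strict_max_ge[OF indep])
      (use J j cont pos r dom in \<open>auto simp: \<nu>_def insert_absorb intro: less_imp_le\<close>)
  finally show ?thesis
    by (simp add: r_def field_simps)
qed

section \<open>Argmax as a random variable\<close>

text \<open>
  Ties are broken by a choice operator. The chosen index is nevertheless a function of the set of all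
  maximisers, a random variable with finitely many values, and this is all that measurability needs.
\<close>
lemma borel_measurable_arg_max_on:
  fixes f :: "'i \<Rightarrow> 'a \<Rightarrow> real"
  assumes S: "finite S" and f: "\<And>i. i \<in> S \<Longrightarrow> f i \<in> borel_measurable M"
  shows "(\<lambda>\<omega>. arg_max_on (\<lambda>i. f i \<omega>) S) \<in> measurable M (count_space UNIV)"
proof -
  define A where "A = (\<lambda>\<omega>. {j\<in>S. \<forall>i\<in>S. f i \<omega> \<le> f j \<omega>})"
  have [measurable]: "f i \<in> borel_measurable M" if "i \<in> S" for i
    using f that .
  have "A \<in> measurable M (count_space (Pow S))"
  proof (subst measurable_count_space_eq2; safe?)
    fix J assume "J \<subseteq> S"
    have "{\<omega>\<in>space M. \<forall>j\<in>S. j \<in> J \<longleftrightarrow> (\<forall>i\<in>S. f i \<omega> \<le> f j \<omega>)} \<in> sets M"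
      using S by measurable
    also have "{\<omega>\<in>space M. \<forall>j\<in>S. j \<in> J \<longleftrightarrow> (\<forall>i\<in>S. f i \<omega> \<le> f j \<omega>)} = A -` {J} \<inter> space M"
      using \<open>J \<subseteq> S\<close> by (auto simp: A_def)
    finally show "A -` {J} \<inter> space M \<in> sets M" .
  qed (use S in \<open>auto simp: A_def\<close>)
  then have "(\<lambda>\<omega>. SOME j. j \<in> A \<omega>) \<in> measurable M (count_space UNIV)"
    by (rule measurable_compose) simp
  also have "(\<lambda>\<omega>. SOME j. j \<in> A \<omega>) = (\<lambda>\<omega>. arg_max_on (\<lambda>i. f i \<omega>) S)"
    by (auto simp: A_def arg_max_on_def arg_max_def is_arg_max_linorder fun_eq_iff
        intro!: arg_cong[where f = Eps])
  finally show ?thesis .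
qed

lemma arg_max_on_in:
  fixes f :: "'i \<Rightarrow> real"
  assumes "finite S" "S \<noteq> {}"
  shows "arg_max_on f S \<in> S"
proof -
  have "Max (f ` S) \<in> f ` S"
    using assms by simp
  then obtain k where "k \<in> S" "f k = Max (f ` S)"
    by force
  then have "\<exists>k. is_arg_max f (\<lambda>x. x \<in> S) k"
    using assms by (auto simp: is_arg_max_linorder intro!: exI[of _ k])
  then show ?thesis
    unfolding arg_max_on_def arg_max_def by (metis (mono_tags, lifting) is_arg_max_def someI_ex)
qed

lemma arg_max_on_eqI:
  fixes f :: "'i \<Rightarrow> real"
  assumes "j \<in> S" "\<And>i. i \<in> S \<Longrightarrow> i \<noteq> j \<Longrightarrow> f i < f j"
  shows "arg_max_on f S = j"
  unfolding arg_max_on_def arg_max_def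
  by (rule some_equality) (use assms in \<open>auto simp: is_arg_max_linorder not_le intro: less_imp_le\<close>, force)

section \<open>Comparison of weights\<close>

text \<open>
  Lower bounds for the point masses bound the mass of \<open>B\<close> from below and, through the complement of
  \<open>B\<close>, also from above; the error does not depend on the number of points.
\<close>
lemma (in prob_space) prob_near_weights:
  fixes T :: "'a \<Rightarrow> 'i" and w :: "'i \<Rightarrow> real"
  assumes T: "T \<in> measurable M (count_space UNIV)" "\<And>\<omega>. \<omega> \<in> space M \<Longrightarrow> T \<omega> \<in> J"
    and J: "finite J" "B \<subseteq> J"
    and w: "\<And>j. j \<in> J \<Longrightarrow> 0 \<le> w j" "sum w J = 1" and \<eta>: "0 \<le> \<eta>"
    and ge: "\<And>j. j \<in> J \<Longrightarrow> (1 - \<eta>) * w j \<le> prob {\<omega> \<in> space M. T \<omega> = j}"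
  shows "\<bar>prob {\<omega> \<in> space M. T \<omega> \<in> B} - sum w B\<bar> \<le> \<eta>"
proof -
  have lower: "sum w C - \<eta> \<le> prob {\<omega> \<in> space M. T \<omega> \<in> C}" if C: "C \<subseteq> J" for C
  proof -
    have "finite C"
      using C J finite_subset by blast
    have "sum w C \<le> 1"
      using sum_mono2[OF J(1) C, of w] w by auto
    then have "sum w C - \<eta> \<le> (1 - \<eta>) * sum w C"
      using \<eta> by (simp add: left_diff_distrib mult_left_le)
    also have "\<dots> \<le> (\<Sum>j\<in>C. prob {\<omega> \<in> space M. T \<omega> = j})"
      unfolding sum_distrib_left using ge C by (intro sum_mono) auto
    also have "\<dots> = prob (\<Union>j\<in>C. {\<omega> \<in> space M. T \<omega> = j})"
      by (rule finite_measure_finite_Union[symmetric])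
        (use T \<open>finite C\<close> in \<open>auto simp: disjoint_family_on_def\<close>)
    also have "(\<Union>j\<in>C. {\<omega> \<in> space M. T \<omega> = j}) = {\<omega> \<in> space M. T \<omega> \<in> C}"
      by auto
    finally show ?thesis .
  qed
  have "prob (space M - {\<omega> \<in> space M. T \<omega> \<in> B}) = 1 - prob {\<omega> \<in> space M. T \<omega> \<in> B}"
  proof (rule prob_compl)
    have "T -` B \<inter> space M \<in> events"
      using T(1) by (rule measurable_sets) simp
    also have "T -` B \<inter> space M = {\<omega> \<in> space M. T \<omega> \<in> B}"
      by auto
    finally show "{\<omega> \<in> space M. T \<omega> \<in> B} \<in> events" .
  qed
  moreover have "space M - {\<omega> \<in> space M. T \<omega> \<in> B} = {\<omega> \<in> space M. T \<omega> \<in> J - B}"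
    using T by auto
  moreover have "sum w (J - B) = 1 - sum w B"
    using sum_diff[OF J, of w] w by simp
  ultimately show ?thesis
    using lower[OF J(2)] lower[of "J - B"] by auto
qed

section \<open>Weak convergence of the normalised argmax\<close>

lemma measure_grid_measure:
  assumes "\<And>j. j \<in> {1..n} \<Longrightarrow> 0 \<le> w j" "A \<in> sets borel"
  shows "measure (grid_measure w n) A = (\<Sum>j | j \<in> {1..n} \<and> real j / real n \<in> A. w j)"
proof -
  have "emeasure (grid_measure w n) A = (\<Sum>j=1..n. ennreal (w j) * indicator A (real j / real n))"
    using assms by (simp add: emeasure_grid_measure)
  also have "\<dots> = (\<Sum>j=1..n. ennreal (w j * indicator A (real j / real n)))"
    by (intro sum.cong) (auto simp: indicator_def)
  also have "\<dots> = ennreal (\<Sum>j=1..n. w j * indicator A (real j / real n))"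
    using assms by (intro sum_ennreal) auto
  also have "(\<Sum>j=1..n. w j * indicator A (real j / real n)) =
      (\<Sum>j | j \<in> {1..n} \<and> real j / real n \<in> A. w j)"
    by (rule sum.mono_neutral_cong_right) auto
  finally show ?thesis
    using assms by (intro measure_eq_emeasure_eq_ennreal sum_nonneg) auto
qed

theorem theorem5:
  fixes P :: "'a measure"
    and X :: "nat \<Rightarrow> 'a \<Rightarrow> real"
    and F \<nu> \<delta> :: "nat \<Rightarrow> real \<Rightarrow> real"
    and c d :: "nat \<Rightarrow> real"
    and \<alpha> m M :: real
    and \<mu> :: "real measure"
    and Xn :: "nat \<Rightarrow> nat \<Rightarrow> 'a \<Rightarrow> real"
  assumes "prob_space P"
    and "prob_space.indep_vars P (\<lambda>_. borel) X {1..}"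
    and "\<And>i. i \<ge> 1 \<Longrightarrow> AE \<omega> in P. X i \<omega> > 0"
  defines "F \<equiv> \<lambda>i x. measure P {\<omega> \<in> space P. X i \<omega> \<le> x}"
  assumes "\<And>i. i \<ge> 1 \<Longrightarrow> F i 0 = 0"
    and "\<And>i x. i \<ge> 1 \<Longrightarrow> x > 0 \<Longrightarrow> F i x > 0"
  defines "\<nu> \<equiv> \<lambda>i x. - ln (F i x)"
  assumes "\<And>i. i \<ge> 1 \<Longrightarrow> continuous_on {0<..} (\<nu> i)"
    and "\<And>i. i \<ge> 1 \<Longrightarrow> strict_antimono_on {0<..} (\<nu> i)"
    and "\<alpha> > 0"
    and "\<And>i. i \<ge> 1 \<Longrightarrow> c i > 0"
    and "\<And>i x. i \<ge> 1 \<Longrightarrow> x > 0 \<Longrightarrow> \<nu> i x = c i * x powr (- \<alpha>) * (1 + \<delta> i x)"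
    and "\<And>i. i \<ge> 1 \<Longrightarrow> continuous_on {0<..} (\<delta> i)"
    and "uniform_limit {1..} (\<lambda>x i. \<delta> i x) (\<lambda>_. 0) at_top"
    and "0 < M" and "0 < m" and "m < 1"
    and "\<And>i x. i \<ge> 1 \<Longrightarrow> x > 0 \<Longrightarrow> - m \<le> \<delta> i x \<and> \<delta> i x \<le> M"
  defines "d \<equiv> \<lambda>n. \<Sum>j=1..n. c j"
  assumes "filterlim d at_top sequentially"
    and "(\<lambda>n. Max (c ` {1..n}) / d n) \<longlonglongrightarrow> 0"
    and "finite_borel_measure \<mu>" and "emeasure \<mu> (- {0..1}) = 0"
    and "weak_conv_m (\<lambda>n. grid_measure (\<lambda>j. c j / d n) n) \<mu>"
  defines "Xn \<equiv> \<lambda>n j \<omega>. d n powr (- 1 / \<alpha>) * X j \<omega>"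
  shows "weak_conv_m
    (\<lambda>n. distr P borel (\<lambda>\<omega>. real (arg_max_on (\<lambda>j. Xn n j \<omega>) {1..n}) / real n)) \<mu>"
proof -
  interpret prob_space P
    by fact
  note indep = \<open>indep_vars (\<lambda>_. borel) X {1..}\<close>
  note F_pos = \<open>\<And>i x. i \<ge> 1 \<Longrightarrow> x > 0 \<Longrightarrow> F i x > 0\<close>
  note c_pos = \<open>\<And>i. i \<ge> 1 \<Longrightarrow> c i > 0\<close>
  have rv [measurable]: "random_variable borel (X i)" if "i \<ge> 1" for i
    using indep that by (auto simp: indep_vars_def)
  have F: "cdf (distr P borel (X i)) = F i" if "i \<ge> 1" for i
  proof
    fix x
    have "X i -` {..x} \<inter> space P = {\<omega> \<in> space P. X i \<omega> \<le> x}"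
      by auto
    then show "cdf (distr P borel (X i)) x = F i x"
      using that by (simp add: cdf_def F_def measure_distr)
  qed
  have F_cont: "isCont (F i) x" if i: "i \<ge> 1" for i x
  proof (cases "0 < x")
    case True
    have "isCont (\<nu> i) x"
      using \<open>\<And>i. i \<ge> 1 \<Longrightarrow> continuous_on {0<..} (\<nu> i)\<close>[OF i] True
      by (simp add: continuous_on_eq_continuous_at)
    then have "isCont (\<lambda>y. exp (- \<nu> i y)) x"
      by (intro continuous_intros)
    moreover have "\<forall>\<^sub>F y in nhds x. exp (- \<nu> i y) = F i y"
      using eventually_nhds_in_open[of "{0<..}" x] True
      by (auto elim!: eventually_mono simp: \<nu>_def F_pos[OF i])
    ultimately show ?thesis
      using isCont_cong by force
  next
    case False
    interpret N: real_distribution "distr P borel (X i)"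
      using rv[OF i] by (rule real_distribution_distr)
    (* All of the half-line below 0 is null, so there are no atoms there, nor at 0. *)
    have "measure (distr P borel (X i)) {x} \<le> measure (distr P borel (X i)) {..0}"
      using False by (intro N.finite_measure_mono) auto
    also have "\<dots> = 0"
      using F[OF i] \<open>\<And>i. i \<ge> 1 \<Longrightarrow> F i 0 = 0\<close>[OF i] by (simp add: cdf_def fun_eq_iff)
    finally show ?thesis
      using N.isCont_cdf[of x] F[OF i] by (simp add: measure_le_0_iff)
  qed
  (* Rescaling by a positive factor preserves strict maxima, so T n = j whenever X j is the strict
     maximum; this inclusion is the only information on ties that is used. *)
  define T where "T = (\<lambda>n \<omega>. arg_max_on (\<lambda>j. Xn n j \<omega>) {1..n})"
  have Xn_meas: "Xn n j \<in> borel_measurable P" if "j \<in> {1..n}" for n j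
    unfolding Xn_def by (intro borel_measurable_times borel_measurable_const rv) (use that in simp)
  have T_meas [measurable]: "T n \<in> measurable P (count_space UNIV)" for n
    unfolding T_def by (rule borel_measurable_arg_max_on[OF _ Xn_meas]) simp_all
  have T_ge: "\<forall>\<^sub>F n in sequentially. \<forall>j\<in>{1..n}.
      (1 - \<eta>) * (c j / d n) \<le> prob {\<omega> \<in> space P. T n \<omega> = j}" if \<eta>: "0 < \<eta>" "\<eta> < 1" for \<eta>
  proof -
    (* With this choice (1 - \<epsilon>) / (1 + \<epsilon>) \<ge> 1 - \<eta> / 2; the truncation costs another factor
       1 - \<eta> / 2, and the product of the two is at least 1 - \<eta>. *)
    define \<epsilon> where "\<epsilon> = \<eta> / 4"
    have \<epsilon>: "0 < \<epsilon>" "\<epsilon> < 1"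
      using \<eta> by (auto simp: \<epsilon>_def)
    have "\<forall>\<^sub>F x in at_top. \<forall>i\<in>{1..}. dist (\<delta> i x) 0 < \<epsilon>"
      using \<open>uniform_limit {1..} (\<lambda>x i. \<delta> i x) (\<lambda>_. 0) at_top\<close> \<epsilon>(1) by (rule uniform_limitD)
    then obtain b where b: "\<And>x i. b \<le> x \<Longrightarrow> i \<ge> 1 \<Longrightarrow> \<bar>\<delta> i x\<bar> < \<epsilon>"
      by (auto simp: eventually_at_top_linorder)
    define a where "a = max b 1"
    have a: "0 < a" "b \<le> a"
      by (auto simp: a_def)
    have "((\<lambda>n. exp (- d n * a powr (- \<alpha>))) \<longlongrightarrow> 0) sequentially"
    proof -
      have "filterlim (\<lambda>n. a powr (- \<alpha>) * d n) at_top sequentially"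
        using a by (intro filterlim_tendsto_pos_mult_at_top[OF tendsto_const]
            \<open>filterlim d at_top sequentially\<close>) auto
      then have "filterlim (\<lambda>n. - (a powr (- \<alpha>) * d n)) at_bot sequentially"
        by (simp add: filterlim_uminus_at_top)
      then have "((\<lambda>n. exp (- (a powr (- \<alpha>) * d n))) \<longlongrightarrow> 0) sequentially"
        by (rule filterlim_compose[OF exp_at_bot])
      then show ?thesis
        by (simp add: mult.commute)
    qed
    then have "\<forall>\<^sub>F n in sequentially. exp (- d n * a powr (- \<alpha>)) < \<eta> / 2"
      by (rule order_tendstoD) (use \<eta> in simp)
    then show ?thesis
    proof (eventually_elim, intro ballI)
      fix n j assume n: "exp (- d n * a powr (- \<alpha>)) < \<eta> / 2" and j: "j \<in> {1..n}"
      have \<nu>: "c i * x powr (- \<alpha>) * (1 - \<epsilon>) \<le> - ln (F i x) \<and> - ln (F i x) \<le> c i * x powr (- \<alpha>) * (1 + \<epsilon>)"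
        if "i \<ge> 1" "a \<le> x" for i x
      proof -
        have "- ln (F i x) = c i * x powr (- \<alpha>) * (1 + \<delta> i x)"
          using that a \<open>\<And>i x. i \<ge> 1 \<Longrightarrow> x > 0 \<Longrightarrow> \<nu> i x = c i * x powr (- \<alpha>) * (1 + \<delta> i x)\<close>[of i x]
          by (simp add: \<nu>_def)
        moreover have "\<bar>\<delta> i x\<bar> < \<epsilon>"
          using that a by (intro b) auto
        ultimately show ?thesis
          using c_pos[OF that(1)] by (auto intro!: mult_left_mono)
      qed
      have "(1 - exp (- d n * a powr (- \<alpha>))) * ((1 - \<epsilon>) / (1 + \<epsilon>)) * (c j / d n)
          \<le> prob {\<omega> \<in> space P. \<forall>i\<in>{1..n} - {j}. X i \<omega> < X j \<omega>}"
        unfolding d_def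
      proof (rule prob_strict_max_ge_power_tail[OF indep _ _ j])
        fix i x assume i: "i \<in> {1..n}"
        then have Fi: "cdf (distr P borel (X i)) = F i" and "i \<ge> 1"
          using F by auto
        show "isCont (cdf (distr P borel (X i))) x" "0 < c i"
          unfolding Fi using F_cont c_pos \<open>i \<ge> 1\<close> by auto
        assume "a \<le> x"
        then show "0 < cdf (distr P borel (X i)) x"
          unfolding Fi using a \<open>i \<ge> 1\<close> by (intro F_pos) auto
        show "- ln (cdf (distr P borel (X i)) x) \<le> c i * x powr (- \<alpha>) * (1 + \<epsilon>)"
          "c i * x powr (- \<alpha>) * (1 - \<epsilon>) \<le> - ln (cdf (distr P borel (X i)) x)"
          unfolding Fi using \<nu>[OF \<open>i \<ge> 1\<close> \<open>a \<le> x\<close>] by auto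
      qed (use \<epsilon> in auto)
      also have "\<dots> \<le> prob {\<omega> \<in> space P. T n \<omega> = j}"
      proof (rule finite_measure_mono)
        have "0 < d n"
          unfolding d_def using j c_pos by (intro sum_pos) auto
        then show "{\<omega> \<in> space P. \<forall>i\<in>{1..n} - {j}. X i \<omega> < X j \<omega>} \<subseteq> {\<omega> \<in> space P. T n \<omega> = j}"
          using j by (auto simp: T_def Xn_def intro!: arg_max_on_eqI)
      qed measurable
      finally have "(1 - exp (- d n * a powr (- \<alpha>))) * ((1 - \<epsilon>) / (1 + \<epsilon>)) * (c j / d n)
          \<le> prob {\<omega> \<in> space P. T n \<omega> = j}" .
      moreover have "1 - \<eta> \<le> (1 - exp (- d n * a powr (- \<alpha>))) * ((1 - \<epsilon>) / (1 + \<epsilon>))"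
      proof -
        have "1 - \<eta> \<le> (1 - \<eta> / 2) * (1 - \<eta> / 2)"
          by (simp add: algebra_simps)
        also have "\<dots> \<le> (1 - exp (- d n * a powr (- \<alpha>))) * ((1 - \<epsilon>) / (1 + \<epsilon>))"
        proof (rule mult_mono)
          show "0 \<le> 1 - exp (- d n * a powr (- \<alpha>))"
            using n \<eta> by linarith
        qed (use n \<eta> in \<open>auto simp: \<epsilon>_def field_simps\<close>)
        finally show ?thesis .
      qed
      moreover have "0 \<le> c j / d n"
        unfolding d_def using j c_pos by (intro divide_nonneg_nonneg sum_nonneg) (auto intro: less_imp_le)
      ultimately show "(1 - \<eta>) * (c j / d n) \<le> prob {\<omega> \<in> space P. T n \<omega> = j}"
        by (meson mult_right_mono order_trans)
    qed
  qed
  let ?D = "\<lambda>n. distr P borel (\<lambda>\<omega>. real (T n \<omega>) / real n)"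
  let ?G = "\<lambda>n. grid_measure (\<lambda>j. c j / d n) n"
  have diff: "(\<lambda>n. cdf (?D n) x - cdf (?G n) x) \<longlonglongrightarrow> 0" for x
  proof (rule tendstoI)
    fix e :: real assume "0 < e"
    define \<eta> where "\<eta> = min (e / 2) (1 / 2)"
    have \<eta>: "0 < \<eta>" "\<eta> < 1" "\<eta> < e"
      using \<open>0 < e\<close> by (auto simp: \<eta>_def min_def)
    show "\<forall>\<^sub>F n in sequentially. dist (cdf (?D n) x - cdf (?G n) x) 0 < e"
      using T_ge[OF \<eta>(1,2)] eventually_ge_at_top[of 1]
    proof eventually_elim
      case (elim n)
      define B where "B = {j. j \<in> {1..n} \<and> real j / real n \<in> {..x}}"
      have d: "0 < d n"
        unfolding d_def using elim(2) c_pos by (intro sum_pos) auto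
      have T_in: "T n \<omega> \<in> {1..n}" for \<omega>
        unfolding T_def using elim(2) by (intro arg_max_on_in) auto
      have "cdf (?D n) x = prob {\<omega> \<in> space P. T n \<omega> \<in> B}"
      proof -
        have "cdf (?D n) x = prob ((\<lambda>\<omega>. real (T n \<omega>) / real n) -` {..x} \<inter> space P)"
          unfolding cdf_def by (rule measure_distr) auto
        also have "(\<lambda>\<omega>. real (T n \<omega>) / real n) -` {..x} \<inter> space P = {\<omega> \<in> space P. T n \<omega> \<in> B}"
          using T_in by (auto simp: B_def)
        finally show ?thesis .
      qed
      moreover have "cdf (?G n) x = (\<Sum>j\<in>B. c j / d n)"
        unfolding cdf_def B_def using d c_pos
        by (intro measure_grid_measure) (auto intro!: divide_nonneg_nonneg less_imp_le)
      moreover have "\<bar>prob {\<omega> \<in> space P. T n \<omega> \<in> B} - (\<Sum>j\<in>B. c j / d n)\<bar> \<le> \<eta>"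
      proof (rule prob_near_weights[OF T_meas])
        show "(\<Sum>j\<in>{1..n}. c j / d n) = 1"
          using d by (simp add: d_def flip: sum_divide_distrib)
        show "0 \<le> c j / d n" if "j \<in> {1..n}" for j
          using that d c_pos[of j] by simp
      qed (use T_in elim \<eta> in \<open>auto simp: B_def\<close>)
      ultimately show ?case
        using \<eta> by simp
    qed
  qed
  show ?thesis
    unfolding weak_conv_m_def weak_conv_def
  proof (intro allI impI)
    fix x assume "isCont (cdf \<mu>) x"
    then have "(\<lambda>n. cdf (?G n) x) \<longlonglongrightarrow> cdf \<mu> x"
      using \<open>weak_conv_m (\<lambda>n. grid_measure (\<lambda>j. c j / d n) n) \<mu>\<close>
      by (simp add: weak_conv_m_def weak_conv_def)
    from tendsto_add[OF diff[of x] this]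
    show "(\<lambda>n. cdf (distr P borel (\<lambda>\<omega>. real (arg_max_on (\<lambda>j. Xn n j \<omega>) {1..n}) / real n)) x)
        \<longlonglongrightarrow> cdf \<mu> x"
      by (simp add: T_def)
  qed
qed

end
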